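(* Let $q$ and $n$ be positive integers and let $\delta=\lceil \log_2 q\rceil$. In the cell-probe model with $w$ bits per cell, for any randomised algorithm solving the online multiplication problem in base $q$, there exist instances such that outputting the $n$ least significant digits of the product takes $\Omega\left(\frac{\delta}{w}n\log n\right)$ expected time.
   Context: Online multiplication problem in base $q$: given two numbers $F,X\in[q^n]=\{0,\dots,q^n-1\}$, each with $n$ digits in base $q$, the task is to output the $n$ least significant base-$q$ digits of the product $F\cdot X$. Only $F$ is known in advance; the digits of $X$ arrive one at a time starting from the least significant digit. When the $i$-th digit of $X$ arrives, the algorithm must output the $i$-th digit of the product before the $(i+1)$-th digit of $X$ arrives. Cell-probe model: memory consists of cells of $w$ bits each (with $w$ at least of order $\log n$ so a cell can hold any address); computation is free and the cost (time) is the number of cells read or written. *)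

theory Defs
  imports "HOL-Probability.Probability"
begin

text \<open>
  The work done in one time step is a decision tree of cell probes; computation between probes is
  free, so the continuation after a read is an arbitrary function of the contents just read.
  Addresses and cell contents are natural numbers, bounded by \<open>2 ^ w\<close> in \<open>fits\<close>.
\<close>

datatype 'a probing =
    Output 'a
  | Read nat "nat \<Rightarrow> 'a probing"
  | Write nat nat "'a probing"

text \<open>A cell of \<open>w\<close> bits must be able to hold any address, so there are \<open>2 ^ w\<close> cells.\<close>

primrec fits :: "nat \<Rightarrow> 'a probing \<Rightarrow> bool" where
  "fits w (Output y) \<longleftrightarrow> True"
| "fits w (Read a k) \<longleftrightarrow> a < 2 ^ w \<and> (\<forall>v<2 ^ w. fits w (k v))"
| "fits w (Write a v p) \<longleftrightarrow> a < 2 ^ w \<and> v < 2 ^ w \<and> fits w p"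

type_synonym memory = "nat \<Rightarrow> nat"

primrec result :: "'a probing \<Rightarrow> memory \<Rightarrow> 'a" where
  "result (Output y) m = y"
| "result (Read a k) m = result (k (m a)) m"
| "result (Write a v p) m = result p (m(a := v))"

primrec final_memory :: "'a probing \<Rightarrow> memory \<Rightarrow> memory" where
  "final_memory (Output y) m = m"
| "final_memory (Read a k) m = final_memory (k (m a)) m"
| "final_memory (Write a v p) m = final_memory p (m(a := v))"

primrec probes :: "'a probing \<Rightarrow> memory \<Rightarrow> nat" where
  "probes (Output y) m = 0"
| "probes (Read a k) m = Suc (probes (k (m a)) m)"
| "probes (Write a v p) m = Suc (probes p (m(a := v)))"

text \<open>
  A deterministic online algorithm. As \<open>F\<close> is known in advance, both the initial memory
  (unlimited free preprocessing) and the behaviour in every step may depend on \<open>F\<close>.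
  In step \<open>i\<close> the algorithm sees only the \<open>i\<close>-th digit of \<open>X\<close>; anything it is to know about
  earlier digits must be kept in the cells.
\<close>

record online_algorithm =
  initial_memory :: "nat \<Rightarrow> memory"  \<comment> \<open>argument: \<open>F\<close>\<close>
  step :: "nat \<Rightarrow> nat \<Rightarrow> nat \<Rightarrow> nat probing"  \<comment> \<open>arguments: \<open>F\<close>, \<open>i\<close>, \<open>i\<close>-th digit of \<open>X\<close>\<close>

definition cell_probe_algorithm :: "nat \<Rightarrow> online_algorithm \<Rightarrow> bool" where
  "cell_probe_algorithm w A \<longleftrightarrow>
     (\<forall>F. \<forall>a<2 ^ w. initial_memory A F a < 2 ^ w) \<and> (\<forall>F i x. fits w (step A F i x))"

text \<open>Digits are indexed from 0, starting with the least significant one.\<close>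

definition digit :: "nat \<Rightarrow> nat \<Rightarrow> nat \<Rightarrow> nat" where
  "digit q N i = N div q ^ i mod q"

primrec memory_before ::
  "nat \<Rightarrow> online_algorithm \<Rightarrow> nat \<Rightarrow> nat \<Rightarrow> nat \<Rightarrow> memory" where
  "memory_before q A F X 0 = initial_memory A F"
| "memory_before q A F X (Suc i) =
     final_memory (step A F i (digit q X i)) (memory_before q A F X i)"

definition output_digit :: "nat \<Rightarrow> online_algorithm \<Rightarrow> nat \<Rightarrow> nat \<Rightarrow> nat \<Rightarrow> nat" where
  "output_digit q A F X i = result (step A F i (digit q X i)) (memory_before q A F X i)"

definition running_time :: "nat \<Rightarrow> nat \<Rightarrow> online_algorithm \<Rightarrow> nat \<Rightarrow> nat \<Rightarrow> nat" where
  "running_time q n A F X =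
     (\<Sum>i<n. probes (step A F i (digit q X i)) (memory_before q A F X i))"

text \<open>
  A randomised algorithm is a probability distribution over deterministic ones (all coins are
  tossed beforehand and are available for free in every step). On every instance it has to be
  correct with probability 1. Coin outcomes for which an algorithm does not halt on some instance
  have probability 0 and may be sent to arbitrary halting behaviour, so nothing is lost by having
  only well-founded probe trees.
\<close>

definition randomised_online_multiplication ::
  "nat \<Rightarrow> nat \<Rightarrow> nat \<Rightarrow> online_algorithm measure \<Rightarrow> bool" where
  "randomised_online_multiplication q n w M \<longleftrightarrow>
     prob_space M \<and>
     (\<forall>A\<in>space M. cell_probe_algorithm w A) \<and>
     (\<forall>F<q ^ n. \<forall>X<q ^ n.
        (\<lambda>A. running_time q n A F X) \<in> measurable M (count_space UNIV) \<and>
        (AE A in M. \<forall>i<n. output_digit q A F X i = digit q (F * X) i))"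

definition expected_time :: "nat \<Rightarrow> nat \<Rightarrow> online_algorithm measure \<Rightarrow> nat \<Rightarrow> nat \<Rightarrow> ennreal" where
  "expected_time q n M F X = (\<integral>\<^sup>+ A. of_nat (running_time q n A F X) \<partial>M)"

end

theory Submission
  imports Defs
begin

text \<open>
  Information transfer: every probe that reads a cell last written at an earlier time is charged to
  the node of the binary tree over the time steps that separates the two times. At a node of
  half-width \<open>l\<close>, the cells transferred from the left to the right half, with their contents,
  determine the output digits of the right half once the digits of \<open>X\<close> outside the left half are
  fixed. For the factor \<open>F = \<Sum>h. q ^ 2 ^ h\<close> those output digits determine the digits in the left
  half up to one bit, so for uniform \<open>X\<close> at least about \<open>l log q / (2 w)\<close> cells are transferred
  for half of the \<open>X\<close>. Summing over the nodes of the \<open>log n\<close> levels gives the bound on average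
  over \<open>X\<close>. It degenerates only when \<open>log q log n\<close> is bounded, and then it is enough that some
  probe is made on \<open>X = 0\<close> or \<open>X = 1\<close>.
\<close>

section \<open>Probe trees\<close>

text \<open>Cells whose contents before the step are inspected: reads of a cell that the same step has
  already overwritten carry no information.\<close>

primrec exposed_reads :: "'a probing \<Rightarrow> memory \<Rightarrow> nat set" where
  "exposed_reads (Output y) m = {}"
| "exposed_reads (Read a k) m = insert a (exposed_reads (k (m a)) m)"
| "exposed_reads (Write a v p) m = exposed_reads p (m(a := v)) - {a}"

primrec written_cells :: "'a probing \<Rightarrow> memory \<Rightarrow> nat set" where
  "written_cells (Output y) m = {}"
| "written_cells (Read a k) m = written_cells (k (m a)) m"
| "written_cells (Write a v p) m = insert a (written_cells p (m(a := v)))"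

lemma finite_exposed_reads [simp]: "finite (exposed_reads p m)"
  by (induction p arbitrary: m) auto

lemma card_exposed_reads: "card (exposed_reads p m) \<le> probes p m"
proof (induction p arbitrary: m)
  case (Read a k)
  then show ?case by (auto simp: card_insert_if le_SucI)
next
  case (Write a v p)
  have "card (exposed_reads p (m(a := v)) - {a}) \<le> card (exposed_reads p (m(a := v)))"
    by (rule card_Diff1_le)
  also have "\<dots> \<le> probes p (m(a := v))" by (rule Write)
  finally show ?case by simp
qed simp

lemma exposed_reads_bounded:
  assumes "fits w p" "\<forall>a<2 ^ w. m a < 2 ^ w"
  shows "exposed_reads p m \<subseteq> {..<2 ^ w}"
  using assms
proof (induction p arbitrary: m)
  case (Write a v p)
  then have "exposed_reads p (m(a := v)) \<subseteq> {..<2 ^ w}" by (intro Write.IH) auto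
  then show ?case by auto
qed auto

lemma final_memory_bounded:
  assumes "fits w p" "\<forall>a<2 ^ w. m a < 2 ^ w"
  shows "\<forall>a<2 ^ w. final_memory p m a < 2 ^ w"
  using assms by (induction p arbitrary: m) auto

lemma final_memory_unwritten: "a \<notin> written_cells p m \<Longrightarrow> final_memory p m a = m a"
  by (induction p arbitrary: m) auto

lemma final_memory_probes_0: "probes p m = 0 \<Longrightarrow> final_memory p m = m"
  by (cases p) auto

text \<open>On a common path the next exposed cell is exposed in both runs, so agreement on the
  intersection of the two read sets already fixes the branch taken. No prior proof that the read
  sets coincide is needed.\<close>

lemma probing_cong:
  assumes "\<forall>a\<in>exposed_reads p m \<inter> exposed_reads p m'. m a = m' a"
  shows "result p m = result p m' \<and> written_cells p m = written_cells p m' \<and>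
    (\<forall>a\<in>written_cells p m. final_memory p m a = final_memory p m' a)"
  using assms
proof (induction p arbitrary: m m')
  case (Read a k)
  then have eq: "m a = m' a" by simp
  have "\<forall>b\<in>exposed_reads (k (m a)) m \<inter> exposed_reads (k (m a)) m'. m b = m' b"
    using Read.prems eq by simp
  from Read.IH[OF rangeI this] show ?case by (simp flip: eq)
next
  case (Write a v p)
  have *: "\<forall>b\<in>exposed_reads p (m(a := v)) \<inter> exposed_reads p (m'(a := v)).
      (m(a := v)) b = (m'(a := v)) b"
    using Write.prems by auto
  note IH = Write.IH[OF *]
  \<comment> \<open>The hypothesis says nothing about \<open>a\<close> itself, but if
    \<open>p\<close> does not overwrite it again, it holds \<open>v\<close> in both runs.\<close>
  moreover have "final_memory p (m(a := v)) a = final_memory p (m'(a := v)) a"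
    using IH final_memory_unwritten[of a p "m(a := v)"] final_memory_unwritten[of a p "m'(a := v)"]
    by (cases "a \<in> written_cells p (m(a := v))") (auto simp add: fun_upd_same simp del: fun_upd_apply)
  ultimately show ?case by (simp del: fun_upd_apply)
qed simp

section \<open>Information transfer\<close>

definition reads_at :: "nat \<Rightarrow> online_algorithm \<Rightarrow> nat \<Rightarrow> nat \<Rightarrow> nat \<Rightarrow> nat set" where
  "reads_at q A F X i = exposed_reads (step A F i (digit q X i)) (memory_before q A F X i)"

definition writes_at :: "nat \<Rightarrow> online_algorithm \<Rightarrow> nat \<Rightarrow> nat \<Rightarrow> nat \<Rightarrow> nat set" where
  "writes_at q A F X i = written_cells (step A F i (digit q X i)) (memory_before q A F X i)"

text \<open>The reading time is part of each element, so that reads in different steps count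
  separately and can be charged to nodes.\<close>

definition transfers ::
  "nat \<Rightarrow> online_algorithm \<Rightarrow> nat \<Rightarrow> nat \<Rightarrow> nat \<Rightarrow> nat \<Rightarrow> nat \<Rightarrow> (nat \<times> nat) set" where
  "transfers q A F X s t e = {(i, a). i \<in> {t..<e} \<and> a \<in> reads_at q A F X i \<and>
     (\<exists>j\<in>{s..<t}. a \<in> writes_at q A F X j) \<and> (\<forall>j\<in>{t..<i}. a \<notin> writes_at q A F X j)}"

text \<open>This is what an encoder stores. The time is dropped, and the content is taken at time
  \<open>t\<close>; it is still the content at the read, since the cell is not overwritten in
  between.\<close>

definition transferred ::
  "nat \<Rightarrow> online_algorithm \<Rightarrow> nat \<Rightarrow> nat \<Rightarrow> nat \<Rightarrow> nat \<Rightarrow> nat \<Rightarrow> (nat \<times> nat) set" where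
  "transferred q A F X s t e =
     (\<lambda>(i, a). (a, memory_before q A F X t a)) ` transfers q A F X s t e"

lemma memory_before_unwritten:
  assumes "s \<le> i" "\<forall>j\<in>{s..<i}. a \<notin> writes_at q A F X j"
  shows "memory_before q A F X i a = memory_before q A F X s a"
  using assms
proof (induction i rule: dec_induct)
  case (step i)
  then show ?case by (auto simp: writes_at_def final_memory_unwritten)
qed simp

lemma memory_before_bounded:
  assumes "cell_probe_algorithm w A"
  shows "\<forall>a<2 ^ w. memory_before q A F X i a < 2 ^ w"
proof (induction i)
  case (Suc i)
  have "fits w (step A F i (digit q X i))" using assms by (simp add: cell_probe_algorithm_def)
  from final_memory_bounded[OF this Suc] show ?case by simp
qed (use assms in \<open>simp add: cell_probe_algorithm_def\<close>)

lemma memory_before_cong: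
  assumes "\<forall>i<s. digit q X i = digit q X' i"
  shows "memory_before q A F X s = memory_before q A F X' s"
  using assms by (induction s) auto

text \<open>The steps from \<open>t\<close> on can be replayed in parallel. A cell inspected by both
  runs was written since \<open>t\<close> and agrees by the invariant, or was written in
  \<open>[s, t)\<close> by one run and is listed with its content in the common set, or dates from
  before \<open>s\<close>, where the runs coincide.\<close>

lemma same_transferred_imp_same_output:
  assumes low: "\<forall>i<s. digit q X i = digit q X' i"
    and high: "\<forall>i\<in>{t..<e}. digit q X i = digit q X' i"
    and "s \<le> t"
    and eq: "transferred q A F X s t e = transferred q A F X' s t e"
    and i: "i \<in> {t..<e}"
  shows "output_digit q A F X i = output_digit q A F X' i"
proof -
  let ?m = "memory_before q A F X" and ?m' = "memory_before q A F X'"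
  let ?W = "writes_at q A F X" and ?W' = "writes_at q A F X'"
  define p where "p i = step A F i (digit q X i)" for i
  \<comment> \<open>Agreement is claimed only for cells written since \<open>t\<close>; the rest of
    the memory may differ.\<close>
  define inv where "inv i \<longleftrightarrow> (\<forall>j\<in>{t..<i}. ?W j = ?W' j) \<and>
    (\<forall>a. (\<exists>j\<in>{t..<i}. a \<in> ?W j) \<longrightarrow> ?m i a = ?m' i a)" for i
  have p': "p i = step A F i (digit q X' i)" if "i \<in> {t..<e}" for i
    using high that by (simp add: p_def)
  have agree: "\<forall>a\<in>exposed_reads (p i) (?m i) \<inter> exposed_reads (p i) (?m' i). ?m i a = ?m' i a"
    if i: "i \<in> {t..<e}" and inv: "inv i" for i
  proof
    fix a assume a: "a \<in> exposed_reads (p i) (?m i) \<inter> exposed_reads (p i) (?m' i)"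
    then have ra: "a \<in> reads_at q A F X i" "a \<in> reads_at q A F X' i"
      using p'[OF i] by (simp_all add: reads_at_def p_def)
    show "?m i a = ?m' i a"
    proof (cases "\<exists>j\<in>{t..<i}. a \<in> ?W j")
      case True
      then show ?thesis using inv by (simp add: inv_def)
    next
      case False
      then have nw: "\<forall>j\<in>{t..<i}. a \<notin> ?W j" "\<forall>j\<in>{t..<i}. a \<notin> ?W' j"
        using inv by (auto simp: inv_def)
      then have mid: "?m i a = ?m t a" "?m' i a = ?m' t a"
        using memory_before_unwritten[of t i] i by auto
      consider "\<exists>j\<in>{s..<t}. a \<in> ?W j" | "\<exists>j\<in>{s..<t}. a \<in> ?W' j"
        | "\<forall>j\<in>{s..<t}. a \<notin> ?W j" "\<forall>j\<in>{s..<t}. a \<notin> ?W' j" by blast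
      then have "?m t a = ?m' t a"
      proof cases
        case 1
        then have "(i, a) \<in> transfers q A F X s t e"
          using i ra nw by (simp add: transfers_def)
        then have "(a, ?m t a) \<in> transferred q A F X s t e"
          unfolding transferred_def by force
        then have "(a, ?m t a) \<in> transferred q A F X' s t e" by (simp add: eq)
        \<comment> \<open>The set for \<open>X'\<close> lists \<open>a\<close> only with the content
          \<open>?m' t a\<close>, so membership forces equality.\<close>
        then show ?thesis by (auto simp: transferred_def)
      next
        case 2
        then have "(i, a) \<in> transfers q A F X' s t e"
          using i ra nw by (simp add: transfers_def)
        then have "(a, ?m' t a) \<in> transferred q A F X' s t e"
          unfolding transferred_def by force
        then have "(a, ?m' t a) \<in> transferred q A F X s t e" by (simp add: eq)
        then show ?thesis by (auto simp: transferred_def)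
      next
        case 3
        then have "?m t a = ?m s a" "?m' t a = ?m' s a"
          using memory_before_unwritten[OF \<open>s \<le> t\<close>] by blast+
        then show ?thesis using memory_before_cong[OF low] by simp
      qed
      then show ?thesis using mid by simp
    qed
  qed
  have inv_step: "inv (Suc i)" if i: "i \<in> {t..<e}" and inv: "inv i" for i
  proof -
    note c = probing_cong[OF agree[OF i inv]]
    have W: "?W i = written_cells (p i) (?m i)" "?W' i = written_cells (p i) (?m' i)"
      using p'[OF i] by (simp_all add: writes_at_def p_def)
    have m: "?m (Suc i) = final_memory (p i) (?m i)" "?m' (Suc i) = final_memory (p i) (?m' i)"
      using p'[OF i] by (simp_all add: p_def)
    have "?m (Suc i) a = ?m' (Suc i) a" if "\<exists>j\<in>{t..<Suc i}. a \<in> ?W j" for a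
    proof (cases "a \<in> ?W i")
      case True
      then show ?thesis using c W m by simp
    next
      case False
      then have "\<exists>j\<in>{t..<i}. a \<in> ?W j" using that by (auto simp: less_Suc_eq)
      then have "?m i a = ?m' i a" using inv by (simp add: inv_def)
      then show ?thesis using False c W m by (simp add: final_memory_unwritten)
    qed
    then show ?thesis using c W inv by (auto simp: inv_def less_Suc_eq)
  qed
  have "i < e \<Longrightarrow> inv i" if "t \<le> i" for i
    using that
  proof (induction i rule: dec_induct)
    case base
    then show ?case by (simp add: inv_def)
  next
    case (step i)
    then show ?case using inv_step[of i] by simp
  qed
  then have "inv i" using i by simp
  from probing_cong[OF agree[OF i this]] show ?thesis
    using p'[OF i] by (simp add: output_digit_def p_def)
qed

lemma finite_transfers [simp]: "finite (transfers q A F X s t e)"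
proof (rule finite_subset)
  show "transfers q A F X s t e \<subseteq> Sigma {t..<e} (reads_at q A F X)"
    by (auto simp: transfers_def)
qed (simp add: reads_at_def)

lemma card_transferred: "card (transferred q A F X s t e) \<le> card (transfers q A F X s t e)"
  unfolding transferred_def by (rule card_image_le) simp

lemma transferred_subset:
  assumes "cell_probe_algorithm w A"
  shows "transferred q A F X s t e \<subseteq> {..<2 ^ w} \<times> {..<2 ^ w}"
proof -
  have "a < 2 ^ w" if "a \<in> reads_at q A F X i" for a i
    using exposed_reads_bounded[OF _ memory_before_bounded[OF assms]] that assms
    unfolding reads_at_def cell_probe_algorithm_def by blast
  then show ?thesis
    using memory_before_bounded[OF assms] by (auto simp: transferred_def transfers_def)
qed

section \<open>Charging reads to the nodes of the binary tree over the time steps\<close>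

abbreviation node_transfers ::
  "nat \<Rightarrow> online_algorithm \<Rightarrow> nat \<Rightarrow> nat \<Rightarrow> nat \<Rightarrow> nat \<Rightarrow> (nat \<times> nat) set" where
  "node_transfers q A F X h m \<equiv>
     transfers q A F X (m * 2 ^ Suc h) (m * 2 ^ Suc h + 2 ^ h) (m * 2 ^ Suc h + 2 * 2 ^ h)"

lemma node_div_eq:
  assumes "i \<in> {m * 2 ^ Suc h + 2 ^ h..<m * 2 ^ Suc h + 2 * 2 ^ h}"
  shows "i div 2 ^ Suc h = (m::nat)"
  using assms by (intro div_nat_eqI) (auto simp: algebra_simps)

text \<open>If \<open>h' > h\<close>, the midpoint of the wider node is a multiple of
  \<open>2 ^ Suc h\<close> not after \<open>i\<close>, hence not after the start of the narrower
  node. The write in the left half of the narrower node then lies between that midpoint and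
  \<open>i\<close>, where the wider node forbids writes to \<open>a\<close>.\<close>

lemma node_transfers_level_le:
  assumes 1: "(i, a) \<in> node_transfers q A F X h m"
    and 2: "(i, a) \<in> node_transfers q A F X h' m'"
  shows "h' \<le> h"
proof (rule ccontr)
  assume "\<not> h' \<le> h"
  then have "Suc h \<le> h'" by simp
  then obtain d where d: "h' = Suc h + d" using le_Suc_ex by blast
  let ?D = "2 ^ Suc h :: nat"
  let ?t' = "m' * 2 ^ Suc h' + 2 ^ h'"
  have t'_dvd: "?t' = ?D * (m' * 2 ^ Suc d + 2 ^ d)"
    by (simp add: d power_add algebra_simps)
  have "?t' \<le> i" using 2 by (simp add: transfers_def)
  then have "?t' div ?D \<le> i div ?D" by (rule div_le_mono)
  also have "i div ?D = m" using 1 by (intro node_div_eq) (simp add: transfers_def)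
  finally have "?t' div ?D * ?D \<le> m * ?D" by (rule mult_le_mono1)
  then have "?t' \<le> m * ?D" using t'_dvd by (simp only: nonzero_mult_div_cancel_left mult.commute) simp
  moreover obtain j where j: "j \<ge> m * ?D" "j < m * ?D + 2 ^ h" "a \<in> writes_at q A F X j"
    using 1 unfolding transfers_def by auto
  moreover have "j < i" using j 1 by (auto simp: transfers_def)
  ultimately have "j \<in> {?t'..<i}" by simp
  then show False using 2 j(3) unfolding transfers_def by blast
qed

lemma node_transfers_disjoint:
  assumes "(i, a) \<in> node_transfers q A F X h m" "(i, a) \<in> node_transfers q A F X h' m'"
  shows "h = h' \<and> m = m'"
proof -
  have h: "h = h'"
    using node_transfers_level_le[OF assms] node_transfers_level_le[OF assms(2,1)] by simp
  have "i div 2 ^ Suc h = m" using assms(1) by (intro node_div_eq) (simp add: transfers_def)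
  moreover have "i div 2 ^ Suc h' = m'"
    using assms(2) by (intro node_div_eq) (simp add: transfers_def)
  ultimately show ?thesis using h by simp
qed

text \<open>The sets of different nodes are disjoint and consist of pairs of a step and a cell read
  in it. Only nodes lying completely within the \<open>n\<close> steps are summed.\<close>

lemma sum_node_transfers_le:
  "(\<Sum>h<H. \<Sum>m<n div 2 ^ Suc h. card (node_transfers q A F X h m)) \<le> running_time q n A F X"
proof -
  let ?V = "Sigma {..<H} (\<lambda>h. {..<n div 2 ^ Suc h})"
  let ?T = "\<lambda>(h, m). node_transfers q A F X h m"
  have "(\<Sum>h<H. \<Sum>m<n div 2 ^ Suc h. card (node_transfers q A F X h m)) = (\<Sum>v\<in>?V. card (?T v))"
    by (simp add: sum.Sigma split_def)
  also have "\<dots> = card (\<Union>v\<in>?V. ?T v)"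
  proof (rule card_UN_disjoint[symmetric])
    show "\<forall>v\<in>?V. \<forall>v'\<in>?V. v \<noteq> v' \<longrightarrow> ?T v \<inter> ?T v' = {}"
      using node_transfers_disjoint[of _ _ q A F X] by (auto split: prod.splits; blast)
  qed auto
  also have "\<dots> \<le> card (Sigma {..<n} (reads_at q A F X))"
  proof (rule card_mono)
    show "(\<Union>v\<in>?V. ?T v) \<subseteq> Sigma {..<n} (reads_at q A F X)"
    proof clarsimp
      fix h m i a assume m: "m < n div (2 * 2 ^ h)" and "(i, a) \<in> transfers q A F X
        (m * (2 * 2 ^ h)) (m * (2 * 2 ^ h) + 2 ^ h) (m * (2 * 2 ^ h) + 2 * 2 ^ h)"
      then have i: "i < m * (2 * 2 ^ h) + 2 * 2 ^ h" "a \<in> reads_at q A F X i"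
        by (auto simp: transfers_def)
      have "Suc m * (2 * 2 ^ h) \<le> n div (2 * 2 ^ h) * (2 * 2 ^ h)"
        using m by (intro mult_le_mono1) simp
      also have "\<dots> \<le> n" by (rule div_times_less_eq_dividend)
      finally show "i < n \<and> a \<in> reads_at q A F X i" using i by simp
    qed
  qed (simp add: reads_at_def)
  also have "\<dots> = (\<Sum>i<n. card (reads_at q A F X i))"
    by (subst card_SigmaI) (auto simp: reads_at_def)
  also have "\<dots> \<le> running_time q n A F X"
    unfolding running_time_def reads_at_def by (intro sum_mono card_exposed_reads)
  finally show ?thesis .
qed

section \<open>Digits\<close>

lemma digit_mod:
  assumes "i < s"
  shows "digit q (N mod q ^ s) i = digit q N i"
proof -
  obtain d where "s = Suc (i + d)" using less_imp_Suc_add[OF assms] by blast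
  then have "q ^ s = q ^ i * (q * q ^ d)" by (simp add: power_add)
  then show ?thesis
    by (cases "q = 0") (simp_all add: digit_def mod_mult2_eq power_0_left)
qed

lemma digit_div: "digit q (N div q ^ t) i = digit q N (t + i)"
  by (simp add: digit_def power_add div_mult2_eq)

lemma mod_power_eq_if_digits_eq:
  assumes "\<forall>i<l. digit q N i = digit q N' i"
  shows "N mod q ^ l = N' mod q ^ l"
  using assms
proof (induction l)
  case (Suc l)
  then have "N mod q ^ l = N' mod q ^ l" "N div q ^ l mod q = N' div q ^ l mod q"
    by (auto simp: digit_def)
  then show ?case by (simp only: power_Suc2 mod_mult2_eq)
qed simp

section \<open>The encoding argument\<close>

text \<open>A nonempty subset is the set of a list of length exactly \<open>k\<close>, padded by
  repeating an element; the factor 2 absorbs the empty set.\<close>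

lemma card_small_subsets:
  assumes "finite P" "P \<noteq> {}"
  shows "card {S. S \<subseteq> P \<and> card S \<le> k} \<le> 2 * card P ^ k"
proof -
  let ?L = "{xs. set xs \<subseteq> P \<and> length xs = k}"
  have "{S. S \<subseteq> P \<and> card S \<le> k} \<subseteq> insert {} (set ` ?L)"
  proof
    fix S assume "S \<in> {S. S \<subseteq> P \<and> card S \<le> k}"
    then have S: "S \<subseteq> P" "card S \<le> k" by auto
    show "S \<in> insert {} (set ` ?L)"
    proof (cases "S = {}")
      case False
      then obtain x where x: "x \<in> S" by blast
      obtain xs where xs: "set xs = S" "distinct xs"
        using finite_distinct_list finite_subset[OF S(1) assms(1)] by blast
      let ?ys = "replicate (k - length xs) x @ xs"
      have "length xs \<le> k" using xs S distinct_card by fastforce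
      then have "length ?ys = k" by simp
      moreover have "set ?ys = S" using x xs by auto
      ultimately show ?thesis using S(1) by (intro insertI2 image_eqI[of _ _ ?ys]) auto
    qed simp
  qed
  moreover have fin: "finite ?L" by (rule finite_lists_length_eq) fact
  ultimately have "card {S. S \<subseteq> P \<and> card S \<le> k} \<le> card (insert {} (set ` ?L))"
    by (intro card_mono) auto
  also have "\<dots> \<le> Suc (card (set ` ?L))" by (rule card_insert_le_m1) auto
  also have "\<dots> \<le> Suc (card ?L)" using card_image_le[OF fin] by simp
  also have "\<dots> = Suc (card P ^ k)" using card_lists_length_eq[OF assms(1)] by simp
  also have "\<dots> \<le> 2 * card P ^ k"
    using assms by (simp add: Suc_le_eq card_gt_0_iff)
  finally show ?thesis .
qed

text \<open>Fix everything but the digits of \<open>X\<close> in \<open>[s, s + l)\<close>, and call the number they form \<open>x\<close>. The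
  product is then congruent modulo \<open>q ^ (s + 2 * l)\<close> to \<open>C + F' q\<^sup>s x\<close>, where \<open>F'\<close> is between \<open>q\<^sup>l\<close>
  and \<open>2 q\<^sup>l\<close>, so the quotient of this number by \<open>q ^ (s + l)\<close> is strictly increasing in \<open>x\<close> and
  varies by less than \<open>2 q\<^sup>l\<close>. Hence the output digits in \<open>[s + l, s + 2 l)\<close>, which give this
  quotient modulo \<open>q\<^sup>l\<close>, determine \<open>x\<close> up to one bit.\<close>

lemma few_instances_with_small_transfer:
  assumes q: "q > 0"
    and A: "cell_probe_algorithm w A"
    and correct: "\<And>X i. X < q ^ n \<Longrightarrow> i < n \<Longrightarrow> output_digit q A F X i = digit q (F * X) i"
    and n: "s + 2 * l \<le> n"
    and F: "q ^ l \<le> F mod q ^ (2 * l)" "F mod q ^ (2 * l) \<le> 2 * q ^ l"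
  shows "card {X. X < q ^ n \<and> card (transferred q A F X s (s + l) (s + 2 * l)) \<le> k}
    \<le> 4 * 2 ^ (2 * w * k) * q ^ (n - l)"
proof -
  let ?T = "\<lambda>X. transferred q A F X s (s + l) (s + 2 * l)"
  let ?B = "{X. X < q ^ n \<and> card (?T X) \<le> k}"
  let ?P = "{..<2 ^ w} \<times> {..<2 ^ w} :: (nat \<times> nat) set"
  define F' where "F' = F mod q ^ (2 * l)"
  define x where "x X = X div q ^ s mod q ^ l" for X
  define C where "C X = F * (X mod q ^ s + q ^ (s + l) * (X div q ^ (s + l)))" for X
  define G where "G X = (C X + F' * q ^ s * x X) div q ^ (s + l)" for X
  define b where "b X = (G X - C X div q ^ (s + l)) div q ^ l" for X
  \<comment> \<open>The code of \<open>X\<close>: its digits outside \<open>[s, s + l)\<close>, the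
    transferred cells, and the bit that the output digits leave open.\<close>
  define \<Phi> where "\<Phi> X = (X mod q ^ s, X div q ^ (s + l), ?T X, b X)" for X
  have X_eq: "X = X mod q ^ s + q ^ s * x X + q ^ (s + l) * (X div q ^ (s + l))" for X
  proof -
    have "X div q ^ s = x X + q ^ l * (X div q ^ (s + l))"
      unfolding x_def by (simp add: power_add div_mult2_eq)
    moreover have "X = X mod q ^ s + q ^ s * (X div q ^ s)" by simp
    ultimately show ?thesis by (metis power_add distrib_left mult.assoc add.assoc)
  qed
  have G_digits: "G X mod q ^ l = (F * X) div q ^ (s + l) mod q ^ l" for X
  proof -
    \<comment> \<open>These digits depend only on \<open>N\<close> modulo
      \<open>q ^ (s + 2 * l)\<close>; as \<open>x X\<close> enters the product with a factor
      \<open>q ^ s\<close>, \<open>F\<close> may be reduced modulo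
      \<open>q ^ (2 * l)\<close>.\<close>
    have window: "N div q ^ (s + l) mod q ^ l = N mod (q ^ s * q ^ (2 * l)) div q ^ (s + l)" for N
    proof -
      have e: "q ^ s * q ^ (2 * l) = q ^ (s + l) * q ^ l"
        by (simp add: power_add mult_2)
      show ?thesis unfolding e using q by (simp add: mod_mult2_eq)
    qed
    have "F * X = C X + q ^ s * (F * x X)"
      by (subst (1) X_eq[of X]) (simp add: C_def algebra_simps)
    moreover
    have "(q ^ s * (F * x X)) mod (q ^ s * q ^ (2 * l))
        = (q ^ s * (F' * x X)) mod (q ^ s * q ^ (2 * l))"
      unfolding F'_def mult_mod_right[symmetric] by (simp add: mod_mult_left_eq)
    then have "(C X + q ^ s * (F * x X)) mod (q ^ s * q ^ (2 * l))
        = (C X + q ^ s * (F' * x X)) mod (q ^ s * q ^ (2 * l))"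
      by (intro mod_add_cong refl)
    ultimately have "(F * X) mod (q ^ s * q ^ (2 * l))
        = (C X + F' * q ^ s * x X) mod (q ^ s * q ^ (2 * l))"
      by (simp add: mult.left_commute mult.assoc)
    then show ?thesis unfolding G_def window by simp
  qed
  have G_mono: "G X < G X'" if "C X = C X'" "x X < x X'" for X X'
  proof -
    \<comment> \<open>Since \<open>F' \<ge> q ^ l\<close>, raising \<open>x\<close> by one adds at
      least the divisor, hence at least 1 to the quotient.\<close>
    have "(C X + F' * q ^ s * x X) + q ^ (s + l) \<le> C X' + F' * q ^ s * x X'"
    proof -
      have "q ^ (s + l) \<le> F' * q ^ s" using F by (simp add: F'_def power_add)
      moreover have "F' * q ^ s * Suc (x X) \<le> F' * q ^ s * x X'"
        using that(2) by (intro mult_le_mono2) simp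
      ultimately show ?thesis using that(1) by simp
    qed
    then have "((C X + F' * q ^ s * x X) + q ^ (s + l)) div q ^ (s + l) \<le> G X'"
      unfolding G_def by (rule div_le_mono)
    then show ?thesis using q by (simp add: G_def)
  qed
  have G_ge: "C X div q ^ (s + l) \<le> G X" for X
    unfolding G_def by (intro div_le_mono) simp
  have b_less: "b X < 2" for X
  proof -
    have "x X < q ^ l" using q by (simp add: x_def)
    have "F' * q ^ s * x X \<le> (2 * q ^ l) * q ^ s * x X"
      using F by (intro mult_le_mono1) (simp add: F'_def)
    then have "G X \<le> (C X + (2 * x X) * q ^ (s + l)) div q ^ (s + l)"
      unfolding G_def by (intro div_le_mono) (simp add: power_add algebra_simps)
    then have "G X - C X div q ^ (s + l) < 2 * q ^ l"
      using q \<open>x X < q ^ l\<close> by simp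
    then show ?thesis unfolding b_def by (intro less_mult_imp_div_less)
  qed
  have "inj_on \<Phi> ?B"
  proof (rule inj_onI)
    fix X X' assume "X \<in> ?B" "X' \<in> ?B" and eq: "\<Phi> X = \<Phi> X'"
    then have X: "X < q ^ n" "X' < q ^ n" by auto
    have e: "X mod q ^ s = X' mod q ^ s" "X div q ^ (s + l) = X' div q ^ (s + l)"
      "?T X = ?T X'" "b X = b X'" using eq by (simp_all add: \<Phi>_def)
    have C: "C X = C X'" using e by (simp add: C_def)
    have "\<forall>i<s. digit q X i = digit q X' i" using e(1) by (metis digit_mod)
    moreover have "\<forall>i\<in>{s + l..<s + 2 * l}. digit q X i = digit q X' i"
    proof
      fix i assume "i \<in> {s + l..<s + 2 * l}"
      then obtain d where "i = s + l + d" using le_Suc_ex by auto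
      then show "digit q X i = digit q X' i" using e(2) by (metis digit_div)
    qed
    ultimately have "\<forall>i\<in>{s + l..<s + 2 * l}. output_digit q A F X i = output_digit q A F X' i"
      using same_transferred_imp_same_output[OF _ _ _ e(3)] by auto
    then have "\<forall>i\<in>{s + l..<s + 2 * l}. digit q (F * X) i = digit q (F * X') i"
      using correct X n by auto
    then have "\<forall>i<l. digit q ((F * X) div q ^ (s + l)) i = digit q ((F * X') div q ^ (s + l)) i"
      by (simp add: digit_div)
    from mod_power_eq_if_digits_eq[OF this] have G: "G X mod q ^ l = G X' mod q ^ l"
      by (simp add: G_digits)
    let ?c = "C X div q ^ (s + l)"
    \<comment> \<open>Truncated subtraction does not respect congruences, so the shift by
      \<open>?c\<close> is done over the integers.\<close>
    have "int (G X) mod int (q ^ l) = int (G X') mod int (q ^ l)"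
      using G by (metis of_nat_mod)
    then have "(int (G X) - int ?c) mod int (q ^ l) = (int (G X') - int ?c) mod int (q ^ l)"
      by (rule mod_diff_cong) simp
    then have "int ((G X - ?c) mod q ^ l) = int ((G X' - ?c) mod q ^ l)"
      using G_ge[of X] G_ge[of X'] C by (simp add: of_nat_mod of_nat_diff)
    moreover have "(G X - ?c) div q ^ l = (G X' - ?c) div q ^ l"
      using e(4) C by (simp add: b_def)
    ultimately have "G X - ?c = G X' - ?c"
      by (metis of_nat_eq_iff div_mult_mod_eq)
    then have "G X = G X'" using G_ge[of X] G_ge[of X'] C by simp
    then have "x X = x X'" using G_mono[of X X'] G_mono[of X' X] C
      by (metis less_irrefl linorder_neqE_nat)
    then show "X = X'" using e X_eq by metis
  qed
  moreover have "\<Phi> ` ?B \<subseteq> {..<q ^ s} \<times> {..<q ^ (n - (s + l))} \<times> {S. S \<subseteq> ?P \<and> card S \<le> k} \<times> {..<2}"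
  proof -
    have "X div q ^ (s + l) < q ^ (n - (s + l))" if "X < q ^ n" for X
      using that n by (intro less_mult_imp_div_less) (simp flip: power_add)
    moreover have "?T X \<subseteq> ?P" for X by (rule transferred_subset[OF A])
    ultimately show ?thesis using q b_less by (intro image_subsetI) (simp add: \<Phi>_def)
  qed
  moreover have "finite {S. S \<subseteq> ?P \<and> card S \<le> k}"
    by (rule finite_subset[of _ "Pow ?P"]) auto
  ultimately have "card ?B \<le> card ({..<q ^ s} \<times> {..<q ^ (n - (s + l))} \<times>
      {S. S \<subseteq> ?P \<and> card S \<le> k} \<times> {..<2::nat})"
    by (intro card_inj_on_le) auto
  also have "\<dots> = 2 * q ^ (n - l) * card {S. S \<subseteq> ?P \<and> card S \<le> k}"
  proof -
    have "q ^ s * q ^ (n - (s + l)) = q ^ (n - l)" using n by (simp flip: power_add)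
    then show ?thesis by (simp add: card_cartesian_product)
  qed
  also have "\<dots> \<le> 2 * q ^ (n - l) * (2 * card ?P ^ k)"
    by (intro mult_le_mono2 card_small_subsets) (auto simp: lessThan_empty_iff)
  also have "\<dots> = 4 * 2 ^ (2 * w * k) * q ^ (n - l)"
  proof -
    have P: "card ?P = 2 ^ (2 * w)" by (simp add: card_cartesian_product mult_2 power_add)
    show ?thesis unfolding P power_mult[symmetric] by simp
  qed
  finally show ?thesis .
qed

text \<open>Take the largest \<open>k\<close> for which the encoding bound leaves at most half of
  the instances with at most \<open>k\<close> transferred cells. The others transfer at least
  \<open>Suc k\<close> cells each, and maximality bounds \<open>Suc k\<close> from below by
  \<open>(l * log 2 q - 3) / (2 * w)\<close>.\<close>

lemma sum_transfer_ge:
  assumes q: "q > 0" and w: "w > 0"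
    and A: "cell_probe_algorithm w A"
    and correct: "\<And>X i. X < q ^ n \<Longrightarrow> i < n \<Longrightarrow> output_digit q A F X i = digit q (F * X) i"
    and n: "s + 2 * l \<le> n"
    and F: "q ^ l \<le> F mod q ^ (2 * l)" "F mod q ^ (2 * l) \<le> 2 * q ^ l"
  shows "real (q ^ n) * ((l * log 2 q - 3) / (4 * real w))
    \<le> (\<Sum>X<q ^ n. card (transfers q A F X s (s + l) (s + 2 * l)))"
proof (cases "2 ^ 3 \<le> q ^ l")
  \<comment> \<open>The exponent 3 collects the factor 4 of the encoding bound and a factor 2 for
    half of the instances. Below \<open>2 ^ 3\<close> not even \<open>k = 0\<close> qualifies, but
    then the claimed bound is not positive.\<close>
  case False
  then have "real (q ^ l) \<le> real (2 ^ 3)" by (simp only: of_nat_le_iff)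
  then have "log 2 (real q ^ l) \<le> log 2 (2 ^ 3)" using q by (intro log_mono) auto
  moreover have "log 2 ((2::real) ^ 3) = 3" by (subst log_nat_power) simp_all
  ultimately have "l * log 2 q \<le> 3" using q by (simp add: log_nat_power)
  then have "(l * log 2 q - 3) / (4 * real w) \<le> 0" by (intro divide_nonpos_nonneg) auto
  then have "real (q ^ n) * ((l * log 2 q - 3) / (4 * real w)) \<le> 0"
    by (intro mult_nonneg_nonpos) auto
  also have "0 \<le> real (\<Sum>X<q ^ n. card (transfers q A F X s (s + l) (s + 2 * l)))"
    by (rule of_nat_0_le_iff)
  finally show ?thesis by (simp only: of_nat_sum)
next
  case True
  let ?t = "\<lambda>X. card (transferred q A F X s (s + l) (s + 2 * l))"
  define k where "k = (GREATEST k. 2 ^ (2 * w * k + 3) \<le> q ^ l)"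
  \<comment> \<open>Without a bound on the candidates, \<open>GREATEST\<close> would be
    unspecified.\<close>
  have bound: "y \<le> q ^ l" if "2 ^ (2 * w * y + 3) \<le> q ^ l" for y
  proof -
    have "y \<le> 2 * w * y + 3" using w by (cases w) auto
    also have "\<dots> \<le> 2 ^ (2 * w * y + 3)" using less_exp less_imp_le by blast
    finally show ?thesis using that by simp
  qed
  have k: "2 ^ (2 * w * k + 3) \<le> q ^ l"
    unfolding k_def by (rule GreatestI_nat[where k = 0 and b = "q ^ l"]) (use True bound in auto)
  have Suc_k: "q ^ l < 2 ^ (2 * w * Suc k + 3)"
  proof (rule ccontr)
    assume "\<not> ?thesis"
    then have "Suc k \<le> k"
      unfolding k_def by (intro Greatest_le_nat[where b = "q ^ l"]) (use bound in auto)
    then show False by simp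
  qed
  have k_ge: "l * log 2 q - 3 \<le> 2 * w * real (Suc k)"
  proof -
    have "real (q ^ l) \<le> real (2 ^ (2 * w * Suc k + 3))" using Suc_k by (simp only: of_nat_le_iff)
    then have "log 2 (real q ^ l) \<le> log 2 (2 ^ (2 * w * Suc k + 3))"
      using q by (intro log_mono) auto
    then show ?thesis using q by (simp add: log_nat_power algebra_simps)
  qed
  let ?B = "{X. X < q ^ n \<and> ?t X \<le> k}"
  have "2 * card ?B \<le> 2 ^ (2 * w * k + 3) * q ^ (n - l)"
    using few_instances_with_small_transfer[OF q A correct n F, of k]
    by (simp add: power_add mult_ac)
  also have "\<dots> \<le> q ^ l * q ^ (n - l)" using k by (intro mult_le_mono1)
  also have "\<dots> = q ^ n" using n by (simp flip: power_add)
  finally have B: "2 * card ?B \<le> q ^ n" .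
  have "card ({..<q ^ n} - ?B) = q ^ n - card ?B"
    by (subst card_Diff_subset) auto
  then have large: "q ^ n \<le> 2 * card ({..<q ^ n} - ?B)" using B by simp
  have "q ^ n * Suc k \<le> 2 * (card ({..<q ^ n} - ?B) * Suc k)"
    using mult_le_mono1[OF large, of "Suc k"] by (simp only: mult.assoc)
  also have "card ({..<q ^ n} - ?B) * Suc k \<le> (\<Sum>X\<in>{..<q ^ n} - ?B. ?t X)"
    using sum_bounded_below[of "{..<q ^ n} - ?B" "Suc k" ?t] by force
  also have "\<dots> \<le> (\<Sum>X<q ^ n. ?t X)" by (rule sum_mono2) auto
  also have "\<dots> \<le> (\<Sum>X<q ^ n. card (transfers q A F X s (s + l) (s + 2 * l)))"
    by (intro sum_mono card_transferred)
  finally have main: "q ^ n * Suc k \<le> 2 * (\<Sum>X<q ^ n. card (transfers q A F X s (s + l) (s + 2 * l)))"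
    by simp
  have "(l * log 2 q - 3) / (4 * real w) \<le> Suc k / 2"
    using k_ge w by (simp add: field_simps)
  then have "real (q ^ n) * ((l * log 2 q - 3) / (4 * real w)) \<le> real (q ^ n) * (Suc k / 2)"
    by (intro mult_left_mono) auto
  also have "\<dots> \<le> real (\<Sum>X<q ^ n. card (transfers q A F X s (s + l) (s + 2 * l)))"
    using main[THEN of_nat_mono[where 'a = real]] by (simp add: algebra_simps)
  finally show ?thesis .
qed

section \<open>The hard factor\<close>

text \<open>With a digit 1 at every position \<open>2 ^ h\<close>, a single factor meets the size
  condition of the encoding argument at all levels at once.\<close>

definition hard_factor :: "nat \<Rightarrow> nat \<Rightarrow> nat" where
  "hard_factor q H = (\<Sum>h<H. q ^ 2 ^ h)"

lemma hard_factor_less: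
  assumes "q \<ge> 2"
  shows "hard_factor q H < q ^ 2 ^ H"
proof (induction H)
  case (Suc H)
  have "2 \<le> q ^ 2 ^ H" using assms self_le_power[of q "2 ^ H"] by simp
  then have "2 * q ^ 2 ^ H \<le> q ^ 2 ^ H * q ^ 2 ^ H" by (rule mult_le_mono1)
  then show ?case using Suc by (simp add: hard_factor_def mult_2 power_add)
qed (use assms in \<open>simp add: hard_factor_def\<close>)

text \<open>The terms above level \<open>h\<close> are divisible by the modulus, and the remaining
  ones sum to less than it.\<close>

lemma hard_factor_mod:
  assumes q: "q \<ge> 2" and "h < H"
  shows "hard_factor q H mod q ^ (2 * 2 ^ h) = q ^ 2 ^ h + hard_factor q h"
proof -
  have "hard_factor q H mod q ^ 2 ^ Suc h = hard_factor q (Suc h)"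
    using Suc_leI[OF \<open>h < H\<close>]
  proof (induction H rule: dec_induct)
    case base
    show ?case using hard_factor_less[OF q] by (rule mod_less)
  next
    case (step H)
    have "q ^ 2 ^ Suc h dvd q ^ 2 ^ H"
      using step by (intro le_imp_power_dvd power_increasing) auto
    then have "hard_factor q (Suc H) mod q ^ 2 ^ Suc h = hard_factor q H mod q ^ 2 ^ Suc h"
      by (auto simp: hard_factor_def dvd_def)
    then show ?case using step by simp
  qed
  then show ?thesis by (simp add: hard_factor_def)
qed

text \<open>Up to the division by \<open>4 * w\<close>, each of the \<open>H\<close> levels
  contributes \<open>n * log 2 q / 4\<close>, having at least \<open>n / (4 * 2 ^ h)\<close>
  complete nodes. The losses of 3 per node form a geometric series of sum at most
  \<open>3 * n\<close>, and \<open>2 * H \<ge> log 2 n\<close> turns the 4 into an 8.\<close>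

lemma sum_running_time_ge:
  assumes q: "q \<ge> 2" and w: "w > 0" and n: "n \<ge> 2"
    and H: "2 ^ H \<le> n" "n < 2 ^ Suc H"
    and A: "cell_probe_algorithm w A"
    and correct: "\<And>X i. X < q ^ n \<Longrightarrow> i < n \<Longrightarrow>
      output_digit q A (hard_factor q H) X i = digit q (hard_factor q H * X) i"
  shows "real (q ^ n) * ((n * log 2 q * log 2 n / 8 - 3 * n) / (4 * real w))
    \<le> (\<Sum>X<q ^ n. running_time q n A (hard_factor q H) X)"
proof -
  let ?F = "hard_factor q H"
  let ?c = "\<lambda>h m X. card (node_transfers q A ?F X h m)"
  let ?r = "\<lambda>h::nat. (2 ^ h * log 2 q - 3) / (4 * real w)"
  define L where "L = log 2 q"
  have L: "L \<ge> 0" using q by (simp add: L_def)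
  have node: "real (q ^ n) * ?r h \<le> (\<Sum>X<q ^ n. real (?c h m X))"
    if h: "h < H" and m: "m < n div 2 ^ Suc h" for h m
  proof -
    have "Suc m * 2 ^ Suc h \<le> n div 2 ^ Suc h * 2 ^ Suc h" using m by (intro mult_le_mono1) simp
    also have "\<dots> \<le> n" by (rule div_times_less_eq_dividend)
    finally have n': "m * 2 ^ Suc h + 2 * 2 ^ h \<le> n" by simp
    have "q ^ 2 ^ h \<le> ?F mod q ^ (2 * 2 ^ h)" "?F mod q ^ (2 * 2 ^ h) \<le> 2 * q ^ 2 ^ h"
      using hard_factor_mod[OF q h] hard_factor_less[OF q, of h] by simp_all
    from sum_transfer_ge[OF _ w A correct n' this] q show ?thesis by simp
  qed
  have level: "n * L / 4 - 3 * (n * (1 / 2) ^ Suc h) \<le> real (n div 2 ^ Suc h) * (2 ^ h * L - 3)"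
    if h: "h < H" for h
  proof -
    let ?d = "n div 2 ^ Suc h"
    have "(2::nat) ^ Suc h \<le> 2 ^ H" using h by (intro power_increasing) auto
    also have "\<dots> \<le> n" by (rule H)
    finally have "1 \<le> ?d" by (simp add: Suc_le_eq div_greater_zero_iff)
    \<comment> \<open>As \<open>?d \<ge> 1\<close>, the incomplete last node is no longer than the
      complete ones together, so rounding down costs at most a factor 2.\<close>
    have "n = 2 ^ Suc h * ?d + n mod 2 ^ Suc h" by simp
    also have "\<dots> \<le> 2 ^ Suc h * ?d + 2 ^ Suc h * ?d"
    proof (intro add_left_mono)
      have "n mod 2 ^ Suc h \<le> 2 ^ Suc h * 1" by (simp add: less_imp_le)
      also have "\<dots> \<le> 2 ^ Suc h * ?d" by (intro mult_le_mono2) fact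
      finally show "n mod 2 ^ Suc h \<le> 2 ^ Suc h * ?d" .
    qed
    finally have "real n \<le> real (2 ^ Suc h * ?d + 2 ^ Suc h * ?d)" by (simp only: of_nat_le_iff)
    then have "n / 4 \<le> real ?d * 2 ^ h" by (simp add: field_simps)
    then have 1: "n / 4 * L \<le> real ?d * 2 ^ h * L" using L by (intro mult_right_mono)
    have "real (?d * 2 ^ Suc h) \<le> real n"
      by (simp only: of_nat_le_iff div_times_less_eq_dividend)
    then have "real ?d \<le> real n / 2 ^ Suc h" by (simp add: field_simps)
    then have "real ?d \<le> n * (1 / 2) ^ Suc h" by (simp add: power_one_over)
    with 1 show ?thesis by (simp add: algebra_simps)
  qed
  have "log 2 n \<le> 2 * H"
  proof -
    have "real n \<le> real (2 ^ Suc H)" using H(2) by (simp only: of_nat_le_iff less_imp_le)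
    then have "log 2 n \<le> log 2 (2 ^ Suc H)" using n by (intro log_mono) auto
    also have "\<dots> = Suc H" by (subst log_nat_power) simp_all
    also have "H \<noteq> 0" using H(2) n by (intro notI) simp
    then have "real (Suc H) \<le> 2 * H" by simp
    finally show ?thesis .
  qed
  then have "n * L * log 2 n / 8 - 3 * n \<le> n * L / 4 * H - 3 * n"
    using L mult_left_mono[of "log 2 n" "2 * H" "n * L"] by (simp add: mult_ac)
  also have "\<dots> \<le> (\<Sum>h<H. n * L / 4 - 3 * (n * (1 / 2) ^ Suc h))"
  proof -
    have "(\<Sum>h<H. (1 / 2 :: real) ^ Suc h) \<le> 1"
    proof -
      have "(\<Sum>h<H. (1 / 2 :: real) ^ Suc h) = 1 - (1 / 2) ^ H"
        by (induction H) simp_all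
      then show ?thesis by simp
    qed
    then have "real n * (\<Sum>h<H. (1 / 2 :: real) ^ Suc h) \<le> real n * 1"
      by (intro mult_left_mono) auto
    moreover have "(\<Sum>h<H. n * L / 4 - 3 * (n * (1 / 2) ^ Suc h))
        = n * L / 4 * H - 3 * (n * (\<Sum>h<H. (1 / 2 :: real) ^ Suc h))"
      by (simp add: sum_subtractf sum_distrib_left del: power_Suc)
    ultimately show ?thesis by linarith
  qed
  also have "\<dots> \<le> (\<Sum>h<H. real (n div 2 ^ Suc h) * (2 ^ h * L - 3))"
    by (intro sum_mono level) simp
  finally have "real (q ^ n) * ((n * L * log 2 n / 8 - 3 * n) / (4 * real w))
      \<le> real (q ^ n) * ((\<Sum>h<H. real (n div 2 ^ Suc h) * (2 ^ h * L - 3)) / (4 * real w))"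
    by (intro mult_left_mono divide_right_mono) auto
  also have "\<dots> = (\<Sum>h<H. \<Sum>m<n div 2 ^ Suc h. real (q ^ n) * ?r h)"
    by (simp add: L_def sum_distrib_left sum_divide_distrib mult_ac)
  also have "\<dots> \<le> (\<Sum>h<H. \<Sum>m<n div 2 ^ Suc h. \<Sum>X<q ^ n. real (?c h m X))"
    by (intro sum_mono node) auto
  also have "\<dots> = (\<Sum>h<H. \<Sum>X<q ^ n. \<Sum>m<n div 2 ^ Suc h. real (?c h m X))"
    by (intro sum.cong refl sum.swap)
  also have "\<dots> = (\<Sum>X<q ^ n. \<Sum>h<H. \<Sum>m<n div 2 ^ Suc h. real (?c h m X))"
    by (rule sum.swap)
  also have "\<dots> \<le> (\<Sum>X<q ^ n. real (running_time q n A ?F X))"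
  proof (rule sum_mono)
    fix X
    show "(\<Sum>h<H. \<Sum>m<n div 2 ^ Suc h. real (?c h m X)) \<le> real (running_time q n A ?F X)"
      using sum_node_transfers_le[where H = H and n = n and q = q and A = A and F = ?F and X = X]
      by (simp only: flip: of_nat_sum)
  qed
  finally show ?thesis by (simp add: L_def)
qed

text \<open>Without a probe nothing about digit 0 of \<open>X\<close> reaches step 1, where both
  instances show the digit 0. Yet the term \<open>q ^ 2 ^ 0\<close> gives the factor a digit 1 at
  position 1, so the outputs there must differ.\<close>

lemma sum_running_time_ge_1:
  assumes q: "q \<ge> 2" and n: "n \<ge> 2" and H: "H \<ge> 1"
    and correct: "\<And>X i. X \<in> {0, 1} \<Longrightarrow> i < n \<Longrightarrow>
      output_digit q A (hard_factor q H) X i = digit q (hard_factor q H * X) i"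
  shows "1 \<le> (\<Sum>X\<in>{0, 1}. running_time q n A (hard_factor q H) X)"
proof (rule ccontr)
  let ?F = "hard_factor q H"
  assume "\<not> ?thesis"
  then have 0: "running_time q n A ?F 0 = 0" "running_time q n A ?F 1 = 0" by simp_all
  have "probes (step A ?F 0 (digit q X 0)) (memory_before q A ?F X 0) = 0"
    if "running_time q n A ?F X = 0" for X
  proof -
    have "probes (step A ?F 0 (digit q X 0)) (memory_before q A ?F X 0) \<le> running_time q n A ?F X"
      unfolding running_time_def using n
      by (intro member_le_sum[where f = "\<lambda>i. probes (step A ?F i (digit q X i)) (memory_before q A ?F X i)"]) auto
    then show ?thesis using that by simp
  qed
  from final_memory_probes_0[OF this[OF 0(1)]] final_memory_probes_0[OF this[OF 0(2)]]
  have "memory_before q A ?F 0 1 = memory_before q A ?F 1 1" by simp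
  moreover have "digit q 0 1 = digit q 1 1" using q by (simp add: digit_def)
  ultimately have "output_digit q A ?F 0 1 = output_digit q A ?F 1 1"
    by (simp add: output_digit_def)
  then have "digit q (?F * 0) 1 = digit q (?F * 1) 1" using correct[of _ 1] n by simp
  then have "?F div q mod q = 0" by (simp add: digit_def)
  moreover have "?F div q mod q = 1"
  proof -
    have "?F mod q ^ 2 = q" using hard_factor_mod[OF q, of 0 H] H by (simp add: hard_factor_def)
    moreover have "?F mod (q * q) div q = ?F div q mod q" using q by (simp add: mod_mult2_eq)
    ultimately show ?thesis using q by (simp add: power2_eq_square)
  qed
  ultimately show False by simp
qed

section \<open>From the average over instances to one hard instance for a randomised
  algorithm\<close>

text \<open>The averaging direction of Yao's principle: linearity carries the almost sure bound over
  to the sum of the expectations, and the largest of them is at least their average.\<close>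

lemma exists_nn_integral_ge:
  fixes T :: "'a \<Rightarrow> 'i \<Rightarrow> nat"
  assumes "prob_space M" and I: "finite I" "I \<noteq> {}" and "b \<ge> 0"
    and meas: "\<And>X. X \<in> I \<Longrightarrow> (\<lambda>A. T A X) \<in> measurable M (count_space UNIV)"
    and ae: "AE A in M. real (card I) * b \<le> (\<Sum>X\<in>I. T A X)"
  shows "\<exists>X\<in>I. ennreal b \<le> (\<integral>\<^sup>+ A. of_nat (T A X) \<partial>M)"
proof -
  interpret prob_space M by fact
  let ?E = "\<lambda>X. \<integral>\<^sup>+ A. of_nat (T A X) \<partial>M"
  let ?m = "Max (?E ` I)"
  have "ennreal (real (card I) * b) = (\<integral>\<^sup>+ A. ennreal (real (card I) * b) \<partial>M)"
    by (simp add: emeasure_space_1)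
  also have "\<dots> \<le> (\<integral>\<^sup>+ A. (\<Sum>X\<in>I. of_nat (T A X)) \<partial>M)"
  proof (rule nn_integral_mono_AE)
    show "AE A in M. ennreal (real (card I) * b) \<le> (\<Sum>X\<in>I. of_nat (T A X))"
      using ae
    proof eventually_elim
      case (elim A)
      then have "ennreal (real (card I) * b) \<le> ennreal (real (\<Sum>X\<in>I. T A X))"
        by (intro ennreal_leI)
      also have "\<dots> = (\<Sum>X\<in>I. of_nat (T A X))"
        by (simp only: flip: ennreal_of_nat_eq_real_of_nat) simp
      finally show ?case .
    qed
  qed
  also have "\<dots> = (\<Sum>X\<in>I. ?E X)"
    by (intro nn_integral_sum measurable_compose[OF meas]) auto
  also have "\<dots> \<le> of_nat (card I) * ?m"
    using I by (intro sum_bounded_above Max_ge) auto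
  finally have "of_nat (card I) * ennreal b \<le> of_nat (card I) * ?m"
    using \<open>b \<ge> 0\<close> by (simp add: ennreal_mult ennreal_of_nat_eq_real_of_nat)
  then have "ennreal b \<le> ?m"
    using I by (subst (asm) ennreal_mult_le_mult_iff) (auto simp: of_nat_less_top less_top[symmetric])
  moreover have "?m \<in> ?E ` I" using I by (intro Max_in) auto
  ultimately show ?thesis by auto
qed

theorem theorem2:
  fixes a :: real
  assumes "a > 0"
  shows "\<exists>c::real. c > 0 \<and>
    (\<forall>(q::nat) (n::nat) (w::nat) (M::online_algorithm measure).
       q \<ge> 1 \<longrightarrow> n \<ge> 1 \<longrightarrow> w \<ge> 1 \<longrightarrow> real w \<ge> a * log 2 (real n) \<longrightarrow>
       randomised_online_multiplication q n w M \<longrightarrow>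
       (\<exists>F<q ^ n. \<exists>X<q ^ n.
          expected_time q n M F X \<ge>
            ennreal (c * (real_of_int \<lceil>log 2 (real q)\<rceil> / real w * real n * log 2 (real n)))))"
proof -
  \<comment> \<open>Chosen generously: the cases below need \<open>2 * c \<le> 1 / 64\<close> and
    \<open>2 * c * (2 ^ 48 * 48) \<le> 1 / 2\<close>.\<close>
  define c :: real where "c = 1 / 2 ^ 60"
  show ?thesis
  proof (intro exI[of _ c] conjI allI impI)
    show "c > 0" by (simp add: c_def)
    fix q n w :: nat and M :: "online_algorithm measure"
    assume q1: "q \<ge> 1" and n1: "n \<ge> 1" and w: "w \<ge> 1"
      and M: "randomised_online_multiplication q n w M"
    let ?bound = "c * (real_of_int \<lceil>log 2 (real q)\<rceil> / real w * real n * log 2 (real n))"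
    show "\<exists>F<q ^ n. \<exists>X<q ^ n. ennreal ?bound \<le> expected_time q n M F X"
    proof (cases "q = 1 \<or> n = 1")
      case True
      then have "?bound = 0" by auto
      then have "ennreal ?bound \<le> expected_time q n M 0 0" by (simp only: ennreal_0 zero_le)
      moreover have "0 < q ^ n" using q1 by simp
      ultimately show ?thesis by blast
    next
      case False
      then have q: "q \<ge> 2" and n: "n \<ge> 2" using q1 n1 by auto
      \<comment> \<open>\<open>H\<close> is the integer part of \<open>log 2 n\<close>, so the hard
        factor stays below \<open>q ^ n\<close>.\<close>
      obtain H where H: "2 ^ H \<le> n" "n < 2 ^ Suc H"
        using ex_power_ivl1[of 2 n] n1 by auto
      have H1: "H \<ge> 1" using H(2) n by (cases H) auto
      define F where "F = hard_factor q H"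
      have "F < q ^ 2 ^ H" unfolding F_def by (rule hard_factor_less[OF q])
      also have "\<dots> \<le> q ^ n" using H(1) q by (intro power_increasing) auto
      finally have F: "F < q ^ n" .
      have prob: "prob_space M" and A: "\<And>A. A \<in> space M \<Longrightarrow> cell_probe_algorithm w A"
        and meas: "\<And>X. X < q ^ n \<Longrightarrow> (\<lambda>A. running_time q n A F X) \<in> measurable M (count_space UNIV)"
        using M F unfolding randomised_online_multiplication_def by blast+
      \<comment> \<open>Correctness holds almost surely for each \<open>X\<close> separately; as
        there are finitely many, one null set serves all of them.\<close>
      have correct: "AE A in M. \<forall>X\<in>{..<q ^ n}. \<forall>i<n. output_digit q A F X i = digit q (F * X) i"
        using M F by (intro AE_finite_allI) (auto simp: randomised_online_multiplication_def)
      have large: ?thesis if "ennreal ?bound \<le> ennreal b" "b \<ge> 0" "I \<subseteq> {..<q ^ n}" "I \<noteq> {}"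
        "AE A in M. real (card I) * b \<le> (\<Sum>X\<in>I. running_time q n A F X)" for b I
      proof -
        have "\<exists>X\<in>I. ennreal b \<le> (\<integral>\<^sup>+ A. of_nat (running_time q n A F X) \<partial>M)"
          using that prob meas finite_subset[of I "{..<q ^ n}"]
          by (intro exists_nn_integral_ge) auto
        then show ?thesis
          using that F unfolding expected_time_def by (meson lessThan_iff order_trans subsetD)
      qed
      define L where "L = log 2 q"
      define N where "N = log 2 n"
      have L: "L \<ge> 1" and N: "N \<ge> 1" using q n by (simp_all add: L_def N_def le_log_iff)
      \<comment> \<open>Rounding up adds less than 1, which is at most \<open>L\<close> because
        \<open>q \<ge> 2\<close>.\<close>
      have "real_of_int \<lceil>L\<rceil> \<le> 2 * L" using L by linarith
      then have "real_of_int \<lceil>L\<rceil> / w * n * N \<le> 2 * L / w * n * N"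
        using N by (intro mult_right_mono divide_right_mono) simp_all
      then have "?bound \<le> c * (2 * L / w * n * N)"
        unfolding L_def N_def by (rule mult_left_mono) (simp add: c_def)
      also have "\<dots> = 2 * c * (n * L * N / w)" by simp
      finally have bound: "?bound \<le> 2 * c * (n * L * N / w)" .
      show ?thesis
      \<comment> \<open>The threshold \<open>48 = 3 * 16\<close> makes the loss \<open>3 * n\<close>
        at most half of the main term \<open>n * L * N / 8\<close>.\<close>
      proof (cases "L * N \<ge> 48")
        case True
        let ?b = "(n * L * N / 8 - 3 * n) / (4 * real w)"
        have "real n * 48 \<le> n * (L * N)" using True by (intro mult_left_mono) auto
        then have num: "n * L * N / 16 \<le> n * L * N / 8 - 3 * n" by (simp add: mult_ac)
        have "2 * c * (n * L * N / w) \<le> 1 / 64 * (n * L * N / w)"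
          using L N by (intro mult_right_mono) (auto simp: c_def)
        also have "\<dots> = (n * L * N / 16) / (4 * real w)" by simp
        also have "\<dots> \<le> ?b" using num by (intro divide_right_mono) auto
        finally have "2 * c * (n * L * N / w) \<le> ?b" .
        then have "ennreal ?bound \<le> ennreal ?b" by (intro ennreal_leI order_trans[OF bound])
        moreover have "?b \<ge> 0" using num L N by (intro divide_nonneg_nonneg order_trans[OF _ num]) auto
        moreover have "AE A in M. real (card {..<q ^ n}) * ?b \<le> (\<Sum>X<q ^ n. running_time q n A F X)"
          using correct AE_space
        proof eventually_elim
          case (elim A)
          then show ?case
            using sum_running_time_ge[OF q _ n H A[of A]] w unfolding F_def L_def N_def by simp
        qed
        moreover have "{..<q ^ n} \<noteq> {}" using F by auto
        ultimately show ?thesis by (intro large[of ?b "{..<q ^ n}"]) auto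
      next
        case False
        \<comment> \<open>Here \<open>n\<close> is bounded, so the claimed bound is below 1/2, the
          average guaranteed by one probe on \<open>X = 0\<close> or \<open>X = 1\<close>.\<close>
        have "L \<le> L * N" "N \<le> L * N" using L N by simp_all
        then have "N < 48" using False by simp
        then have "real n < 2 powr 48" using n by (simp add: N_def log_less_iff)
        then have "n * (L * N) \<le> 2 ^ 48 * 48" using False L N
          by (intro mult_mono) (auto simp: powr_numeral)
        then have "n * (L * N) / w \<le> 2 ^ 48 * 48 / 1" using w by (intro frac_le) auto
        then have "2 * c * (n * L * N / w) \<le> 2 * c * (2 ^ 48 * 48)"
          by (intro mult_left_mono) (auto simp: c_def mult.assoc)
        also have "\<dots> \<le> 1 / 2" by (simp add: c_def)
        finally have "ennreal ?bound \<le> ennreal (1 / 2)"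
          by (intro ennreal_leI order_trans[OF bound])
        moreover have "q ^ n \<ge> 2"
          using q n self_le_power[of q n] by simp
        moreover have "AE A in M. real (card {0, 1 :: nat}) * (1 / 2) \<le> (\<Sum>X\<in>{0, 1}. running_time q n A F X)"
          using correct
        proof eventually_elim
          case (elim A)
          have "X \<in> {..<q ^ n}" if "X \<in> {0, 1}" for X
            using that \<open>q ^ n \<ge> 2\<close> q by auto
          then have "1 \<le> (\<Sum>X\<in>{0, 1}. running_time q n A F X)"
            using elim unfolding F_def by (intro sum_running_time_ge_1 q n H1) blast
          then show ?case by simp
        qed
        ultimately show ?thesis by (intro large[of "1 / 2" "{0, 1}"]) (use q in auto)
      qed
    qed
  qed
qed

end
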